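(* Let $M\in\mathbb N$, $\vec k=(k_1,\dots,k_M)$ with all $k_j>0$, $\rho\in\mathbb R$, $v\in\mathbb R$. Let $$P_n^{(\alpha,\beta)}(x)=\frac{(\alpha+1)_n}{n!}\,{}_2F_1\left(\begin{matrix}-n,\ \alpha+\beta+n+1\\\alpha+1\end{matrix};\frac{1-x}2\right)$$ be the Jacobi polynomials. Then $\mathrm{BEP}(\vec k)$ is dual to $\mathrm{SIP}_{\mathsf R}(\vec k,\rho)$ with duality function $$\hat P^v_{\mathrm J}(\vec y,\xi)=\prod_{j=1}^M(v+E_{j-1}^-(\vec y))^{\xi_j}\frac{\xi_j!}{(k_j)_{\xi_j}}P^{(k_j-1,\,h^+_{j+1}(\xi))}_{\xi_j}\Big(1+\frac{2y_j}{v+E_{j-1}^-(\vec y)}\Big)$$ $$=\prod_{j=1}^M(v+E_{j-1}^-(\vec y))^{\xi_j}\,{}_2F_1\left(\begin{matrix}-\xi_j,\ \xi_j+h^+_{j+1}(\xi)+k_j\\k_j\end{matrix};\frac{-y_j}{v+E_{j-1}^-(\vec y)}\right),$$ i.e. $[L^{\mathrm{BEP}}_{\vec k}\hat P^v_{\mathrm J}(\cdot,\xi)](\vec y)=[L^{\mathrm{SIP}_{\mathsf R}}_{\vec k,\rho}\hat P^v_{\mathrm J}(\vec y,\cdot)](\xi)$ for all $\vec y\in\mathbb R_{\ge0}^M$ and $\xi\in\mathcal S_\rho$.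
   Context: $(a)_n=a(a+1)\cdots(a+n-1)$; ${}_2F_1(a,b;c;z)=\sum_{n\ge0}\frac{(a)_n(b)_n}{(c)_n}\frac{z^n}{n!}$ (finite sum over $n\le N$ if $a=-N$). $E_j^-(\vec y)=\sum_{i=1}^jy_i$, $E_0^-=0$. Each factor of $\hat P^v_{\mathrm J}$ is a polynomial in $\vec y$ and $v$, extended by continuity when $v+E_{j-1}^-(\vec y)=0$. $\mathrm{BEP}(\vec k)$ on $\mathbb R_{\ge0}^M$: $$[L^{\mathrm{BEP}}_{\vec k}f](\vec y)=\sum_{j=1}^{M-1}y_jy_{j+1}\Big(\frac{\partial}{\partial y_j}-\frac{\partial}{\partial y_{j+1}}\Big)^2f(\vec y)+(k_jy_{j+1}-k_{j+1}y_j)\Big(\frac{\partial}{\partial y_j}-\frac{\partial}{\partial y_{j+1}}\Big)f(\vec y).$$ Right dynamic SIP: $X_d=\mathbb Z_{\ge0}^M$, $|\xi|=\sum_j\xi_j$; $\mathcal S_\rho=X_d$ if $\rho>-1$, $\mathcal S_\rho=\{\xi\in X_d:2|\xi|+|\vec k|+\rho<0\}$ if $\rho\le-1$; $h^+_{M+1}=\rho$, $h^+_j(\xi)=\rho+\sum_{i=j}^M(2\xi_i+k_i)$; $\xi^{j,m}$ is $\xi$ with one particle moved from $j$ to $m$ if $\xi_j\ge1$, else $\xi$. On $\mathcal S_\rho$, $$[L^{\mathrm{SIP}_{\mathsf R}}_{\vec k,\rho}f](\xi)=\sum_{j=1}^{M-1}C_j^+[f(\xi^{j,j+1})-f(\xi)]+C_{j+1}^-[f(\xi^{j+1,j})-f(\xi)],$$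 $$C_j^+=\frac{\xi_j(\xi_{j+1}+k_{j+1})(h^+_j-\xi_j)(h^+_{j+1}-\xi_{j+1})}{h^+_{j+1}(h^+_{j+1}+1)},\qquad C_j^-=\frac{\xi_j(\xi_{j-1}+k_{j-1})(h^+_j+\xi_{j-1})(h^+_{j+1}+\xi_j)}{h^+_j(h^+_j-1)},$$ where a rate is $0$ when the departing site $j$ is empty and $(h^+_{j+1}-\xi_{j+1})/h^+_{j+1}$ is read as $1$ when $\xi_{j+1}=0$. *)

theory Defs
  imports "HOL-Analysis.Analysis"
begin

section \<open>Jacobi polynomials\<close>

text \<open>If \<open>a = -N\<close>, all terms with \<open>n > N\<close> vanish, so the series is the usual finite sum.\<close>

definition hyp2F1 :: "real \<Rightarrow> real \<Rightarrow> real \<Rightarrow> real \<Rightarrow> real" where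
  "hyp2F1 a b c z = (\<Sum>n. pochhammer a n * pochhammer b n / pochhammer c n * (z ^ n / fact n))"

definition jacobi_P :: "nat \<Rightarrow> real \<Rightarrow> real \<Rightarrow> real \<Rightarrow> real" where
  "jacobi_P n \<alpha> \<beta> x =
     pochhammer (\<alpha> + 1) n / fact n *
     hyp2F1 (- real n) (\<alpha> + \<beta> + real n + 1) (\<alpha> + 1) ((1 - x) / 2)"

section \<open>Brownian energy process\<close>

text \<open>Sites are \<open>1, \<dots>, M\<close>; vectors indexed by the sites are extensional functions on
  \<open>{1..M}\<close>, i.e. \<open>undefined\<close> off the sites.\<close>

definition energy_space :: "nat \<Rightarrow> (nat \<Rightarrow> real) set" where
  "energy_space M = {1..M} \<rightarrow>\<^sub>E {0..}"

text \<open>The domain is the closed orthant, so the derivative is taken within \<open>{0..}\<close>; it is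
  one-sided on the face \<open>y j = 0\<close>.\<close>

definition partial_deriv :: "nat \<Rightarrow> ((nat \<Rightarrow> real) \<Rightarrow> real) \<Rightarrow> (nat \<Rightarrow> real) \<Rightarrow> real" where
  "partial_deriv j f y = vector_derivative (\<lambda>t. f (y(j := t))) (at (y j) within {0..})"

definition partial_diff :: "nat \<Rightarrow> ((nat \<Rightarrow> real) \<Rightarrow> real) \<Rightarrow> (nat \<Rightarrow> real) \<Rightarrow> real" where
  "partial_diff j f y = partial_deriv j f y - partial_deriv (j + 1) f y"

definition L_BEP ::
    "nat \<Rightarrow> (nat \<Rightarrow> real) \<Rightarrow> ((nat \<Rightarrow> real) \<Rightarrow> real) \<Rightarrow> (nat \<Rightarrow> real) \<Rightarrow> real" where
  "L_BEP M k f y =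
     (\<Sum>j\<in>{1..<M}. y j * y (j + 1) * partial_diff j (partial_diff j f) y
        + (k j * y (j + 1) - k (j + 1) * y j) * partial_diff j f y)"

section \<open>Right dynamic symmetric inclusion process\<close>

definition particle_space :: "nat \<Rightarrow> (nat \<Rightarrow> nat) set" where
  "particle_space M = {1..M} \<rightarrow>\<^sub>E UNIV"

definition SIP_R_space :: "nat \<Rightarrow> (nat \<Rightarrow> real) \<Rightarrow> real \<Rightarrow> (nat \<Rightarrow> nat) set" where
  "SIP_R_space M k \<rho> =
     (if \<rho> > -1 then particle_space M
      else {\<xi> \<in> particle_space M.
              2 * real (\<Sum>j\<in>{1..M}. \<xi> j) + (\<Sum>j\<in>{1..M}. k j) + \<rho> < 0})"

definition height_R :: "nat \<Rightarrow> (nat \<Rightarrow> real) \<Rightarrow> real \<Rightarrow> nat \<Rightarrow> (nat \<Rightarrow> nat) \<Rightarrow> real" where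
  "height_R M k \<rho> j \<xi> = \<rho> + (\<Sum>i\<in>{j..M}. 2 * real (\<xi> i) + k i)"

definition move :: "nat \<Rightarrow> nat \<Rightarrow> (nat \<Rightarrow> nat) \<Rightarrow> nat \<Rightarrow> nat" where
  "move j m \<xi> = (if \<xi> j \<ge> 1 then \<xi>(j := \<xi> j - 1, m := \<xi> m + 1) else \<xi>)"

text \<open>The quotient \<open>(h - \<xi> (j + 1)) / h\<close>, with \<open>h\<close> the height at \<open>j + 1\<close>, is read as \<open>1\<close> if
  site \<open>j + 1\<close> is empty; this matters because \<open>h = 0\<close> can then occur when \<open>-1 < \<rho> < 0\<close>. With
  the two conventions below, no denominator vanishes on the state space.\<close>

definition rate_plus ::
    "nat \<Rightarrow> (nat \<Rightarrow> real) \<Rightarrow> real \<Rightarrow> nat \<Rightarrow> (nat \<Rightarrow> nat) \<Rightarrow> real" where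
  "rate_plus M k \<rho> j \<xi> =
     (let h = height_R M k \<rho> in
      if \<xi> j = 0 then 0
      else real (\<xi> j) * (real (\<xi> (j + 1)) + k (j + 1)) *
           ((h j \<xi> - real (\<xi> j)) / (h (j + 1) \<xi> + 1)) *
           (if \<xi> (j + 1) = 0 then 1
            else (h (j + 1) \<xi> - real (\<xi> (j + 1))) / h (j + 1) \<xi>))"

definition rate_minus ::
    "nat \<Rightarrow> (nat \<Rightarrow> real) \<Rightarrow> real \<Rightarrow> nat \<Rightarrow> (nat \<Rightarrow> nat) \<Rightarrow> real" where
  "rate_minus M k \<rho> j \<xi> =
     (let h = height_R M k \<rho> in
      if \<xi> j = 0 then 0
      else real (\<xi> j) * (real (\<xi> (j - 1)) + k (j - 1)) *
           (h j \<xi> + real (\<xi> (j - 1))) * (h (j + 1) \<xi> + real (\<xi> j)) /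
           (h j \<xi> * (h j \<xi> - 1)))"

definition L_SIP_R ::
    "nat \<Rightarrow> (nat \<Rightarrow> real) \<Rightarrow> real \<Rightarrow> ((nat \<Rightarrow> nat) \<Rightarrow> real) \<Rightarrow> (nat \<Rightarrow> nat) \<Rightarrow> real" where
  "L_SIP_R M k \<rho> f \<xi> =
     (\<Sum>j\<in>{1..<M}. rate_plus M k \<rho> j \<xi> * (f (move j (j + 1) \<xi>) - f \<xi>)
        + rate_minus M k \<rho> (j + 1) \<xi> * (f (move (j + 1) j \<xi>) - f \<xi>))"

section \<open>Duality\<close>

definition generator_duality ::
    "(('a \<Rightarrow> real) \<Rightarrow> 'a \<Rightarrow> real) \<Rightarrow> 'a set \<Rightarrow> (('b \<Rightarrow> real) \<Rightarrow> 'b \<Rightarrow> real) \<Rightarrow> 'b set \<Rightarrow>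
     ('a \<Rightarrow> 'b \<Rightarrow> real) \<Rightarrow> bool" where
  "generator_duality L1 \<Omega>1 L2 \<Omega>2 D \<longleftrightarrow>
     (\<forall>x\<in>\<Omega>1. \<forall>\<xi>\<in>\<Omega>2. L1 (\<lambda>y. D y \<xi>) x = L2 (\<lambda>\<eta>. D x \<eta>) \<xi>)"

definition E_minus :: "nat \<Rightarrow> (nat \<Rightarrow> real) \<Rightarrow> real" where
  "E_minus j y = (\<Sum>i\<in>{1..j}. y i)"

definition cont_ext0 :: "(real \<Rightarrow> real) \<Rightarrow> real \<Rightarrow> real" where
  "cont_ext0 g s = (if s = 0 then Lim (at 0) g else g s)"

text \<open>Each factor is a polynomial in \<open>y j\<close> and \<open>s = v + E_minus (j - 1) y\<close>; its value at
  \<open>s = 0\<close> is its limit as \<open>s \<rightarrow> 0\<close> for fixed \<open>y j\<close>.\<close>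

definition duality_P ::
    "nat \<Rightarrow> (nat \<Rightarrow> real) \<Rightarrow> real \<Rightarrow> real \<Rightarrow> (nat \<Rightarrow> real) \<Rightarrow> (nat \<Rightarrow> nat) \<Rightarrow> real" where
  "duality_P M k \<rho> v y \<xi> =
     (\<Prod>j\<in>{1..M}.
        cont_ext0
          (\<lambda>s. s ^ \<xi> j * (fact (\<xi> j) / pochhammer (k j) (\<xi> j)) *
               jacobi_P (\<xi> j) (k j - 1) (height_R M k \<rho> (j + 1) \<xi>) (1 + 2 * y j / s))
          (v + E_minus (j - 1) y))"

definition duality_P_hyp ::
    "nat \<Rightarrow> (nat \<Rightarrow> real) \<Rightarrow> real \<Rightarrow> real \<Rightarrow> (nat \<Rightarrow> real) \<Rightarrow> (nat \<Rightarrow> nat) \<Rightarrow> real" where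
  "duality_P_hyp M k \<rho> v y \<xi> =
     (\<Prod>j\<in>{1..M}.
        cont_ext0
          (\<lambda>s. s ^ \<xi> j *
               hyp2F1 (- real (\<xi> j)) (real (\<xi> j) + height_R M k \<rho> (j + 1) \<xi> + k j) (k j)
                 (- y j / s))
          (v + E_minus (j - 1) y))"

end

theory Submission
  imports Defs
begin

text \<open>Only the factors at sites \<open>j\<close> and \<open>j + 1\<close> see the \<open>j\<close>-th summand of either generator: all
  the others depend on \<open>y j\<close>, \<open>y (j + 1)\<close> and \<open>\<xi> j\<close>, \<open>\<xi> (j + 1)\<close> only through their sums. After
  Pfaff's transformation of the factor at \<open>j + 1\<close> the two factors are \<open>p(x)\<close> and \<open>q(x')\<close> with
  parameters that are constant along the energy exchange, so the BEP operator becomes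
  \<open>x x' (p'' q + 2 p' q' + p q'') + (a x' - b x) (p' q + p q')\<close>. The hypergeometric equation reduces
  it to first order, and the contiguous relations that shift the first two parameters of the Gauss
  function simultaneously by \<open>1\<close> or \<open>-1\<close> have exactly the numerators of the SIP rates as
  coefficients.\<close>

section \<open>Homogenised hypergeometric polynomials\<close>

text \<open>Homogeneous of degree \<open>n\<close> in \<open>(x, s)\<close>: the value at
  \<open>s = 0\<close> is then defined without a limit, and \<open>n - i\<close> is never truncated,
  as \<open>i \<le> n\<close>.\<close>

definition hom_poly :: "nat \<Rightarrow> (nat \<Rightarrow> real) \<Rightarrow> real \<Rightarrow> real \<Rightarrow> real" where
  "hom_poly n a x s = (\<Sum>i\<le>n. a i * x ^ i * s ^ (n - i))"

definition hyp_coeff :: "nat \<Rightarrow> real \<Rightarrow> real \<Rightarrow> nat \<Rightarrow> real" where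
  "hyp_coeff n B c i = real (n choose i) * pochhammer B i / pochhammer c i"

text \<open>For \<open>s \<noteq> 0\<close> this is \<open>s\<^sup>n F(-n, B; c; -x/s)\<close> with \<open>F\<close> the Gauss function
  (see \<open>hyp2F1_hyp_hom\<close>); the minus sign in the argument cancels against the one in
  \<open>(-n)\<^sub>i\<close>.\<close>

definition hyp_hom :: "nat \<Rightarrow> real \<Rightarrow> real \<Rightarrow> real \<Rightarrow> real \<Rightarrow> real" where
  "hyp_hom n B c = hom_poly n (hyp_coeff n B c)"

text \<open>Differentiating a Gauss function in its argument raises all three parameters by 1. For
  \<open>n = 0\<close> the prefactor makes the truncated \<open>n - 1\<close> harmless.\<close>

definition hyp_hom_deriv :: "nat \<Rightarrow> real \<Rightarrow> real \<Rightarrow> real \<Rightarrow> real \<Rightarrow> real" where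
  "hyp_hom_deriv n B c x s = real n * B / c * hyp_hom (n - 1) (B + 1) (c + 1) x s"

definition hyp_hom_deriv2 :: "nat \<Rightarrow> real \<Rightarrow> real \<Rightarrow> real \<Rightarrow> real \<Rightarrow> real" where
  "hyp_hom_deriv2 n B c x s = real n * B / c * hyp_hom_deriv (n - 1) (B + 1) (c + 1) x s"

section \<open>Coefficient calculus\<close>

lemma hom_poly_add: "hom_poly n a x s + hom_poly n b x s = hom_poly n (\<lambda>i. a i + b i) x s"
  by (simp add: hom_poly_def sum.distrib algebra_simps)

lemma hom_poly_cmult: "r * hom_poly n a x s = hom_poly n (\<lambda>i. r * a i) x s"
  by (simp add: hom_poly_def sum_distrib_left mult.assoc)

text \<open>Raising the degree adds one coefficient, which has to vanish; for
  \<open>hyp_coeff n\<close> it does by \<open>hyp_coeff_beyond\<close>.\<close>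

lemma hom_poly_times_s:
  assumes "a (Suc n) = 0"
  shows "s * hom_poly n a x s = hom_poly (Suc n) a x s"
  using assms by (auto simp: hom_poly_def sum_distrib_left Suc_diff_le algebra_simps intro!: sum.cong)

lemma hom_poly_times_x:
  "x * hom_poly n a x s = hom_poly (Suc n) (\<lambda>i. if i = 0 then 0 else a (i - 1)) x s"
  unfolding hom_poly_def sum.atMost_Suc_shift
  by (auto simp: sum_distrib_left algebra_simps intro!: sum.cong)

lemma hom_poly_Suc_cong:
  assumes "a 0 = b 0" "\<And>j. j \<le> n \<Longrightarrow> a (Suc j) = b (Suc j)"
  shows "hom_poly (Suc n) a x s = hom_poly (Suc n) b x s"
proof -
  have "a i = b i" if "i \<le> Suc n" for i
    using assms that by (cases i) auto
  then show ?thesis by (auto simp: hom_poly_def intro!: sum.cong)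
qed

text \<open>The subtraction is real, so this covers \<open>j \<ge> n\<close> too, where both sides
  are 0.\<close>

lemma binomial_Suc_ratio: "real (n choose Suc j) = (real n - real j) / (real j + 1) * real (n choose j)"
proof -
  have "real (Suc j * (Suc n choose Suc j)) = real (Suc n * (n choose j))"
    by (simp only: Suc_times_binomial)
  then show ?thesis by (simp add: field_simps)
qed

lemma hyp_coeff_0 [simp]: "hyp_coeff n B c 0 = 1"
  by (simp add: hyp_coeff_def)

lemma hyp_coeff_beyond [simp]: "n < i \<Longrightarrow> hyp_coeff n B c i = 0"
  by (simp add: hyp_coeff_def)

lemma hyp_coeff_Suc:
  "hyp_coeff n B c (Suc j) =
     (real n - real j) * (B + real j) / ((real j + 1) * (c + real j)) * hyp_coeff n B c j"
  unfolding hyp_coeff_def binomial_Suc_ratio pochhammer_Suc by (simp add: field_simps)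

lemma hyp_coeff_Suc_Suc:
  "hyp_coeff (Suc n) B c (Suc j) =
     (real n + 1) * B / ((real j + 1) * c) * hyp_coeff n (B + 1) (c + 1) j"
proof -
  have "real (Suc j * (Suc n choose Suc j)) = real (Suc n * (n choose j))"
    by (simp only: Suc_times_binomial)
  then have *: "real (Suc n choose Suc j) = (real n + 1) / (real j + 1) * real (n choose j)"
    by (simp add: field_simps)
  show ?thesis unfolding hyp_coeff_def pochhammer_rec * by (simp add: mult_ac)
qed

lemma pochhammer_pos_neq_0: "(c::real) > 0 \<Longrightarrow> pochhammer c i \<noteq> 0"
  using pochhammer_pos[of c i] by simp

lemma hyp_coeff_c_Suc:
  assumes "c > 0"
  shows "c * hyp_coeff n B c i = (c + real i) * hyp_coeff n B (c + 1) i"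
proof -
  have *: "pochhammer (c + 1) i = pochhammer c i * (c + real i) / c"
    using assms by (simp add: pochhammer_rec flip: pochhammer_Suc)
  have "pochhammer c i \<noteq> 0" "c + real i \<noteq> 0"
    using assms by (auto intro!: pochhammer_pos_neq_0)
  then show ?thesis unfolding hyp_coeff_def * using assms by (simp add: divide_simps)
qed

lemma hyp_coeff_B_Suc: "B * hyp_coeff n (B + 1) c i = (B + real i) * hyp_coeff n B c i"
proof -
  have *: "pochhammer B i * (B + real i) = B * pochhammer (B + 1) i"
    by (simp add: pochhammer_rec flip: pochhammer_Suc)
  have "B * hyp_coeff n (B + 1) c i = real (n choose i) * (B * pochhammer (B + 1) i) / pochhammer c i"
    by (simp add: hyp_coeff_def)
  also have "\<dots> = (B + real i) * hyp_coeff n B c i"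
    unfolding *[symmetric] by (simp add: hyp_coeff_def)
  finally show ?thesis .
qed

text \<open>The contiguous relations below compare coefficients: \<open>x \<partial>\<^sub>x\<close> multiplies the \<open>i\<close>-th coefficient
  by \<open>i\<close>, whereas \<open>\<partial>\<^sub>x\<close> alone would shift indices and run into truncated subtraction.\<close>

lemma x_times_hyp_hom_deriv:
  "x * hyp_hom_deriv n B c x s = hom_poly n (\<lambda>i. real i * hyp_coeff n B c i) x s"
proof (cases n)
  case (Suc k)
  have "x * hyp_hom_deriv n B c x s = real n * B / c * (x * hyp_hom k (B + 1) (c + 1) x s)"
    by (simp add: hyp_hom_deriv_def Suc)
  also have "\<dots> = hom_poly n (\<lambda>i. real i * hyp_coeff n B c i) x s"
    unfolding hyp_hom_def hom_poly_times_x hom_poly_cmult Suc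
  proof (rule hom_poly_Suc_cong)
    have "real (Suc j) * hyp_coeff (Suc k) B c (Suc j) = real (Suc k) * B / c * hyp_coeff k (B + 1) (c + 1) j" for j
      by (simp add: hyp_coeff_Suc_Suc add.commute)
    then show "real (Suc k) * B / c * (if Suc j = 0 then 0 else hyp_coeff k (B + 1) (c + 1) (Suc j - 1))
      = real (Suc j) * hyp_coeff (Suc k) B c (Suc j)" for j by simp
  qed simp
  finally show ?thesis .
qed (simp add: hyp_hom_deriv_def hom_poly_def)

text \<open>This is the formula for the derivative of
  \<open>z^(c-1) (1-z)^(a+b-c) F(a, b; c; z)\<close>, with \<open>a = -n\<close>,
  \<open>b = B\<close>, \<open>z = -x/s\<close>. It lowers all three parameters and so reverses
  differentiation.\<close>

lemma hyp_hom_lowering: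
  assumes "c > 1"
  shows "x * (s + x) * hyp_hom_deriv n B c x s + ((c - 1) * s + (B - 1 - real n) * x) * hyp_hom n B c x s
    = (c - 1) * hyp_hom (Suc n) (B - 1) (c - 1) x s"
proof -
  have "x * (s + x) * hyp_hom_deriv n B c x s + ((c - 1) * s + (B - 1 - real n) * x) * hyp_hom n B c x s
    = s * hom_poly n (\<lambda>i. real i * hyp_coeff n B c i) x s + x * hom_poly n (\<lambda>i. real i * hyp_coeff n B c i) x s
     + (c - 1) * (s * hyp_hom n B c x s) + (B - 1 - real n) * (x * hyp_hom n B c x s)"
    unfolding x_times_hyp_hom_deriv[symmetric] by (simp add: algebra_simps)
  \<comment> \<open>All terms are brought to degree \<open>Suc n\<close>; both sides then have
    multiples of \<open>hyp_coeff n B c j\<close> as coefficients of index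
    \<open>Suc j\<close>.\<close>
  also have "\<dots> = (c - 1) * hyp_hom (Suc n) (B - 1) (c - 1) x s"
    unfolding hyp_hom_def
    by (subst hom_poly_times_s, simp)+
      (simp only: hom_poly_times_x hom_poly_cmult hom_poly_add, rule hom_poly_Suc_cong,
        use assms in \<open>simp_all add: hyp_coeff_Suc[of n B c] hyp_coeff_Suc_Suc[of n "B - 1" "c - 1"] divide_simps\<close>,
        algebra)
  finally show ?thesis .
qed

text \<open>The derivative is a multiple of the polynomial with raised parameters, and
  \<open>hyp_hom_lowering\<close> applied to that polynomial returns to the original one.\<close>

lemma hyp_hom_ode:
  assumes "c > 0"
  shows "x * (s + x) * hyp_hom_deriv2 n B c x s + (c * s + (B - real n + 1) * x) * hyp_hom_deriv n B c x s
    = real n * B * hyp_hom n B c x s"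
proof (cases n)
  case (Suc k)
  define K where "K = real n * B / c"
  have "hyp_hom_deriv2 n B c x s = K * hyp_hom_deriv k (B + 1) (c + 1) x s"
    "hyp_hom_deriv n B c x s = K * hyp_hom k (B + 1) (c + 1) x s"
    unfolding hyp_hom_deriv2_def hyp_hom_deriv_def[of n] K_def by (simp_all add: Suc)
  then have "x * (s + x) * hyp_hom_deriv2 n B c x s + (c * s + (B - real n + 1) * x) * hyp_hom_deriv n B c x s
    = K * (x * (s + x) * hyp_hom_deriv k (B + 1) (c + 1) x s
        + (c * s + (B - real k) * x) * hyp_hom k (B + 1) (c + 1) x s)"
    by (simp add: Suc algebra_simps)
  also have "\<dots> = K * (c * hyp_hom n B c x s)"
    using hyp_hom_lowering[of "c + 1" x s k "B + 1"] assms by (simp add: Suc)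
  finally show ?thesis using assms by (simp add: K_def)
qed (simp add: hyp_hom_deriv_def hyp_hom_deriv2_def)

text \<open>Here the Gauss parameters \<open>-n\<close> and \<open>B\<close> both rise by 1. The
  factor \<open>n B\<close> is kept, since it may vanish and reappears in the rates.\<close>

lemma hyp_hom_contiguous_down:
  assumes "c > 0"
  shows "real n * B * (s + x) * hyp_hom (n - 1) (B + 1) c x s
    = real n * B * hyp_hom n B c x s - (B - real n + 1 - c) * x * hyp_hom_deriv n B c x s"
proof (cases n)
  case (Suc k)
  have coeff: "real n * B * hyp_coeff k (B + 1) c i = (real n - real i) * (B + real i) * hyp_coeff n B c i" for i
  proof -
    \<comment> \<open>Absorption for binomials; beyond \<open>Suc k\<close> both binomials are 0,
      which avoids truncation in \<open>Suc k - i\<close>.\<close>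
    have "real n * real (k choose i) = (real n - real i) * real (n choose i)"
    proof (cases "i \<le> Suc k")
      case True
      have "real (Suc k * (k choose i)) = real ((Suc k - i) * (Suc k choose i))"
        using binomial_absorb_comp[of "Suc k" i] by simp
      then show ?thesis using True by (simp only: Suc of_nat_diff of_nat_mult)
    qed (simp add: Suc not_le binomial_eq_0)
    then have "real n * hyp_coeff k B c i = (real n - real i) * hyp_coeff n B c i"
      by (simp add: hyp_coeff_def)
    then show ?thesis using hyp_coeff_B_Suc[of B k c i] by algebra
  qed
  have "real n * B * (s + x) * hyp_hom k (B + 1) c x s =
     s * (real n * B * hyp_hom k (B + 1) c x s) + x * (real n * B * hyp_hom k (B + 1) c x s)"
    by (simp add: algebra_simps)
  also have "\<dots> = real n * B * hyp_hom n B c x s + (- (B - real n + 1 - c)) * (x * hyp_hom_deriv n B c x s)"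
    unfolding hyp_hom_def x_times_hyp_hom_deriv
    apply (simp only: hom_poly_cmult[of "real n * B"])
    apply (subst hom_poly_times_s, simp)
    apply (simp only: hom_poly_times_x)
    apply (simp only: hom_poly_cmult hom_poly_add coeff)
    apply (simp only: Suc)
    apply (rule hom_poly_Suc_cong)
    using assms by (simp_all add: hyp_coeff_Suc divide_simps) (simp add: Suc algebra_simps)
  finally show ?thesis by (simp add: Suc algebra_simps)
qed (simp add: hyp_hom_deriv_def)

text \<open>Here \<open>-n\<close> and \<open>B\<close> both fall by 1. In Gauss notation
  \<open>e = (c - a)(c - b)\<close> and \<open>g = c + 1 - a - b\<close> with \<open>a = -n\<close>,
  \<open>b = B\<close>.\<close>

lemma hyp_hom_contiguous_up:
  fixes n :: nat and B c x s :: real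
  assumes "c > 0"
  defines "e \<equiv> (c + real n) * (c - B)" and "g \<equiv> c + 1 + real n - B"
  shows "e * hyp_hom (Suc n) (B - 1) c x s
    = (e * (s + x) - g * (g - 1) * x) * hyp_hom n B c x s
      + g * x * (s + x) * hyp_hom_deriv n B c x s"
proof -
  have coeff: "hyp_coeff (Suc n) (B - 1) c (Suc j) =
      (real n + 1) * (B - 1) / ((real j + 1) * (c + real j)) * hyp_coeff n B c j" for j
  proof -
    have "hyp_coeff n B (c + 1) j = c / (c + real j) * hyp_coeff n B c j"
      using hyp_coeff_c_Suc[OF assms(1), of n B j] assms(1) by (simp add: field_simps)
    then show ?thesis unfolding hyp_coeff_Suc_Suc[of n "B - 1" c j] using assms(1) by simp
  qed
  have "(e * (s + x) - g * (g - 1) * x) * hyp_hom n B c x s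
      + g * x * (s + x) * hyp_hom_deriv n B c x s
    = e * (s * hyp_hom n B c x s) + (e - g * (g - 1)) * (x * hyp_hom n B c x s)
      + g * (s * (x * hyp_hom_deriv n B c x s)) + g * (x * (x * hyp_hom_deriv n B c x s))"
    by (simp add: algebra_simps)
  also have "\<dots> = e * hyp_hom (Suc n) (B - 1) c x s"
    unfolding x_times_hyp_hom_deriv unfolding hyp_hom_def
    apply (subst hom_poly_times_s, simp)+
    apply (simp only: hom_poly_times_x hom_poly_cmult hom_poly_add)
    apply (rule hom_poly_Suc_cong)
    using assms(1) by (simp_all add: coeff hyp_coeff_Suc[of n B c] divide_simps) (simp add: e_def g_def, algebra)
  finally show ?thesis by simp
qed

text \<open>Pascal's rule on coefficients, combined with \<open>(B)_(j+1) = B (B+1)_j\<close> and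
  the same for \<open>c\<close>.\<close>

lemma hyp_hom_Suc:
  assumes "c > 0"
  shows "hyp_hom (Suc n) B c x s = s * hyp_hom n B c x s + B / c * (x * hyp_hom n (B + 1) (c + 1) x s)"
proof -
  have coeff: "B * hyp_coeff n (B + 1) (c + 1) j = c * ((B + real j) / (c + real j) * hyp_coeff n B c j)" for j
  proof -
    have "hyp_coeff n B (c + 1) j = c / (c + real j) * hyp_coeff n B c j"
      using hyp_coeff_c_Suc[OF assms, of n B j] assms by (simp add: field_simps)
    then show ?thesis using hyp_coeff_B_Suc[of B n "c + 1" j] by simp
  qed
  have coeff1: "B / c * hyp_coeff n (B + 1) (c + 1) j = (B + real j) / (c + real j) * hyp_coeff n B c j" for j
    using coeff[of j] assms by (simp add: field_simps)
  have coeff2: "hyp_coeff (Suc n) B c (Suc j) =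
      (real n + 1) / (real j + 1) * ((B + real j) / (c + real j) * hyp_coeff n B c j)" for j
    unfolding coeff1[symmetric] hyp_coeff_Suc_Suc by simp
  have "hyp_coeff (Suc n) B c (Suc j) =
      hyp_coeff n B c (Suc j) + B / c * hyp_coeff n (B + 1) (c + 1) j" for j
    unfolding coeff1 coeff2 hyp_coeff_Suc[of n] using assms by (simp add: divide_simps) algebra
  then show ?thesis
    unfolding hyp_hom_def
    apply (subst hom_poly_times_s, simp)
    apply (simp only: hom_poly_times_x hom_poly_cmult hom_poly_add)
    by (rule hom_poly_Suc_cong) simp_all
qed

text \<open>Coefficientwise this is \<open>c + i = (c - B) + (B + i)\<close>.\<close>

lemma hyp_hom_split_c:
  assumes "c > 0"
  shows "c * hyp_hom n B c x s = (c - B) * hyp_hom n B (c + 1) x s + B * hyp_hom n (B + 1) (c + 1) x s"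
  unfolding hyp_hom_def hom_poly_cmult hom_poly_add hyp_coeff_B_Suc hyp_coeff_c_Suc[OF assms]
  by (simp add: algebra_simps)

text \<open>For the factor at site \<open>j + 1\<close>, where \<open>s\<close> is the partial energy up
  to site \<open>j\<close>, the new second argument \<open>s + x\<close> is invariant under energy exchange between \<open>j\<close> and
  \<open>j + 1\<close>.\<close>

lemma hyp_hom_pfaff:
  assumes "c > 0"
  shows "hyp_hom n B c x s = hyp_hom n (c - B) c (- x) (s + x)"
  using assms
proof (induction n arbitrary: B c)
  case (Suc n)
  \<comment> \<open>The recursion raises \<open>c - B\<close> and \<open>c\<close> together, which
    keeps \<open>B\<close> fixed; the induction hypothesis is therefore needed at \<open>c\<close>
    and at \<open>c + 1\<close>.\<close>
  have "hyp_hom (Suc n) (c - B) c (- x) (s + x)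
    = (s + x) * hyp_hom n B c x s - (c - B) / c * (x * hyp_hom n B (c + 1) x s)"
    using hyp_hom_Suc[OF Suc.prems, of n "c - B" "- x" "s + x"] Suc.IH[of c B] Suc.IH[of "c + 1" B]
      Suc.prems by (simp add: algebra_simps)
  also have "\<dots> = (s * hyp_hom n B c x s) +
     x / c * (c * hyp_hom n B c x s - (c - B) * hyp_hom n B (c + 1) x s)"
    using Suc.prems by (simp add: field_simps)
  also have "\<dots> = hyp_hom (Suc n) B c x s"
    unfolding hyp_hom_split_c[OF Suc.prems] hyp_hom_Suc[OF Suc.prems] by simp
  finally show ?case by simp
qed (simp add: hyp_hom_def hom_poly_def)

section \<open>Continuity, derivatives and the link to the Gauss function\<close>

lemma continuous_on_hom_poly [continuous_intros]:
  assumes "continuous_on S f" "continuous_on S g"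
  shows "continuous_on S (\<lambda>t. hom_poly n a (f t) (g t))"
  unfolding hom_poly_def by (intro continuous_intros assms)

lemma hom_poly_Suc_deriv_x:
  "((\<lambda>x. hom_poly (Suc n) a x s) has_real_derivative
      hom_poly n (\<lambda>i. real (Suc i) * a (Suc i)) x s) (at x)"
proof -
  have "((\<lambda>x. hom_poly (Suc n) a x s) has_real_derivative
      (\<Sum>i\<le>Suc n. a i * (real i * x ^ (i - 1)) * s ^ (Suc n - i))) (at x)"
    unfolding hom_poly_def by (auto intro!: derivative_eq_intros simp del: sum.atMost_Suc simp: mult_ac)
  also have "(\<Sum>i\<le>Suc n. a i * (real i * x ^ (i - 1)) * s ^ (Suc n - i))
      = hom_poly n (\<lambda>i. real (Suc i) * a (Suc i)) x s"
    unfolding sum.atMost_Suc_shift hom_poly_def by (auto intro!: sum.cong)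
  finally show ?thesis .
qed

lemma hyp_hom_has_deriv:
  "((\<lambda>x. hyp_hom n B c x s) has_real_derivative hyp_hom_deriv n B c x s) (at x)"
proof (cases n)
  case (Suc k)
  have "real (Suc j) * hyp_coeff (Suc k) B c (Suc j) = real (Suc k) * B / c * hyp_coeff k (B + 1) (c + 1) j" for j
    by (simp add: hyp_coeff_Suc_Suc add.commute)
  then have "hom_poly k (\<lambda>i. real (Suc i) * hyp_coeff n B c (Suc i)) x s = hyp_hom_deriv n B c x s"
    unfolding hyp_hom_deriv_def hyp_hom_def hom_poly_cmult Suc by simp
  then show ?thesis
    unfolding hyp_hom_def using hom_poly_Suc_deriv_x[of k "hyp_coeff n B c" s x] by (simp add: Suc)
qed (simp add: hyp_hom_def hom_poly_def hyp_hom_deriv_def)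

lemma hyp2F1_hyp_hom:
  assumes "s \<noteq> 0"
  shows "s ^ n * hyp2F1 (- real n) B c (- x / s) = hyp_hom n B c x s"
proof -
  have neg: "pochhammer (- real n) i = (-1) ^ i * fact i * real (n choose i)" for i
  proof -
    have "real (n choose i) = real n gchoose i" by (simp add: binomial_gbinomial)
    then show ?thesis
      by (simp add: gbinomial_pochhammer mult.assoc flip: power_add mult_2 power_mult_distrib)
  qed
  have "hyp2F1 (- real n) B c (- x / s) =
      (\<Sum>i\<le>n. pochhammer (- real n) i * pochhammer B i / pochhammer c i * ((- x / s) ^ i / fact i))"
    unfolding hyp2F1_def by (rule suminf_finite) (auto simp: neg)
  also have "s ^ n * \<dots> = hyp_hom n B c x s"
    unfolding hyp_hom_def hom_poly_def sum_distrib_left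
  proof (rule sum.cong)
    fix i assume "i \<in> {..n}"
    then have "s ^ n = s ^ i * s ^ (n - i)" by (simp flip: power_add)
    moreover have "(-1) ^ i * (- x / s) ^ i = x ^ i / s ^ i"
      by (simp add: power_divide flip: power_mult_distrib)
    ultimately show "s ^ n * (pochhammer (- real n) i * pochhammer B i / pochhammer c i * ((- x / s) ^ i / fact i))
      = hyp_coeff n B c i * x ^ i * s ^ (n - i)"
      using assms by (simp add: neg hyp_coeff_def field_simps)
  qed simp
  finally show ?thesis .
qed

text \<open>A polynomial in \<open>s\<close> agrees with the function away from 0, so its value at 0
  is the limit.\<close>

lemma cont_ext0_hyp_hom:
  "cont_ext0 (\<lambda>s. s ^ n * hyp2F1 (- real n) B c (- x / s)) s = hyp_hom n B c x s"
proof -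
  have "continuous_on UNIV (\<lambda>s. hyp_hom n B c x s)"
    unfolding hyp_hom_def by (intro continuous_intros)
  then have "(hyp_hom n B c x \<longlongrightarrow> hyp_hom n B c x 0) (at 0)"
    by (simp add: continuous_on_def)
  moreover have "\<forall>\<^sub>F s in at 0. hyp_hom n B c x s = s ^ n * hyp2F1 (- real n) B c (- x / s)"
    unfolding eventually_at_filter by (rule always_eventually) (metis hyp2F1_hyp_hom)
  ultimately have "((\<lambda>s. s ^ n * hyp2F1 (- real n) B c (- x / s)) \<longlongrightarrow> hyp_hom n B c x 0) (at 0)"
    by (rule Lim_transform_eventually)
  then show ?thesis
    unfolding cont_ext0_def using hyp2F1_hyp_hom[of s n B c x] by (auto intro!: tendsto_Lim)
qed

lemma jacobi_P_hyp2F1: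
  assumes "a > 0"
  shows "fact n / pochhammer a n * jacobi_P n (a - 1) \<beta> (1 + 2 * x / s)
    = hyp2F1 (- real n) (real n + \<beta> + a) a (- x / s)"
proof -
  have "(1 - (1 + 2 * x / s)) / 2 = - x / s" by simp
  moreover have "a - 1 + \<beta> + real n + 1 = real n + \<beta> + a" "a - 1 + 1 = a" by simp_all
  ultimately show ?thesis
    using pochhammer_pos[OF assms, of n] unfolding jacobi_P_def by (simp only:) simp
qed

section \<open>The duality function as a product of polynomials\<close>

definition dual_factor :: "nat \<Rightarrow> (nat \<Rightarrow> real) \<Rightarrow> real \<Rightarrow> real \<Rightarrow> (nat \<Rightarrow> nat) \<Rightarrow> nat \<Rightarrow> (nat \<Rightarrow> real) \<Rightarrow> real" where
  "dual_factor M k \<rho> v \<xi> j y =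
     hyp_hom (\<xi> j) (real (\<xi> j) + height_R M k \<rho> (j + 1) \<xi> + k j) (k j) (y j) (v + E_minus (j - 1) y)"

lemma duality_P_hyp_eq: "duality_P_hyp M k \<rho> v y \<xi> = (\<Prod>j\<in>{1..M}. dual_factor M k \<rho> v \<xi> j y)"
  unfolding duality_P_hyp_def dual_factor_def by (simp only: cont_ext0_hyp_hom)

lemma duality_P_eq_hyp:
  assumes "\<And>j. j \<in> {1..M} \<Longrightarrow> k j > 0"
  shows "duality_P M k \<rho> v y \<xi> = duality_P_hyp M k \<rho> v y \<xi>"
  unfolding duality_P_def duality_P_hyp_def
proof (rule prod.cong)
  fix j assume "j \<in> {1..M}"
  then have "k j > 0" by (rule assms)
  show "cont_ext0 (\<lambda>s. s ^ \<xi> j * (fact (\<xi> j) / pochhammer (k j) (\<xi> j)) *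
          jacobi_P (\<xi> j) (k j - 1) (height_R M k \<rho> (j + 1) \<xi>) (1 + 2 * y j / s)) (v + E_minus (j - 1) y)
      = cont_ext0 (\<lambda>s. s ^ \<xi> j * hyp2F1 (- real (\<xi> j))
          (real (\<xi> j) + height_R M k \<rho> (j + 1) \<xi> + k j) (k j) (- y j / s)) (v + E_minus (j - 1) y)"
    by (subst mult.assoc, subst jacobi_P_hyp2F1[OF \<open>k j > 0\<close>], rule refl)
qed simp

section \<open>The two-site identity\<close>

text \<open>After multiplication by \<open>s + x\<close>, the differential equations eliminate \<open>p''\<close> and \<open>q''\<close>, and the
  contiguous relations turn each numerator of a rate times a shifted polynomial into a first-order
  expression in \<open>p\<close> or \<open>q\<close>. What remains is an identity between the coefficients of \<open>p q\<close>,
  \<open>p' q\<close>, \<open>p q'\<close> and \<open>p' q'\<close>.\<close>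

lemma two_site_identity_generic:
  fixes a b x y s h :: real and n m :: nat
  assumes a: "a > 0" and b: "b > 0" and \<epsilon>: "s + x \<noteq> 0"
  defines "\<beta> \<equiv> h + 2 * real m + b"
  assumes n: "n = 0 \<or> \<beta> \<noteq> -1" and m: "m = 0 \<or> \<beta> \<noteq> 0 \<and> \<beta> \<noteq> 1"
  defines "p \<equiv> hyp_hom n (real n + \<beta> + a) a x s" and "p' \<equiv> hyp_hom_deriv n (real n + \<beta> + a) a x s"
    and "p'' \<equiv> hyp_hom_deriv2 n (real n + \<beta> + a) a x s"
    and "q \<equiv> hyp_hom m (- real m - h) b (- y) (s + x + y)"
    and "q' \<equiv> hyp_hom_deriv m (- real m - h) b (- y) (s + x + y)"
    and "q'' \<equiv> hyp_hom_deriv2 m (- real m - h) b (- y) (s + x + y)"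
  defines "p_dn \<equiv> hyp_hom (n - 1) (real n + \<beta> + a + 1) a x s"
    and "p_up \<equiv> hyp_hom (Suc n) (real n + \<beta> + a - 1) a x s"
    and "q_dn \<equiv> hyp_hom (m - 1) (- real m - h + 1) b (- y) (s + x + y)"
    and "q_up \<equiv> hyp_hom (Suc m) (- real m - h - 1) b (- y) (s + x + y)"
  defines "Cp \<equiv> real n * (real m + b) * ((\<beta> + real n + a) / (\<beta> + 1)) * (if m = 0 then 1 else (\<beta> - real m) / \<beta>)"
    and "Cm \<equiv> real m * (real n + a) * (\<beta> + real n) * (h + real m) / (\<beta> * (\<beta> - 1))"
  shows "x * y * (p'' * q + 2 * p' * q' + p * q'') + (a * y - b * x) * (p' * q + p * q')
    = Cp * (p_dn * q_up - p * q) + Cm * (p_up * q_dn - p * q)"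
proof -
  \<comment> \<open>\<open>\<beta>\<close> and \<open>h\<close> play the heights at sites
    \<open>j + 1\<close> and \<open>j + 2\<close>, and \<open>n\<close>, \<open>m\<close> the
    occupations of \<open>j\<close> and \<open>j + 1\<close>.\<close>
  have ode_p: "x * (s + x) * p'' + (a * s + (a + \<beta> + 1) * x) * p' = real n * (real n + \<beta> + a) * p"
    using hyp_hom_ode[OF a, of x s n "real n + \<beta> + a"] unfolding p_def p'_def p''_def by (simp add: algebra_simps)
  have ode_q: "y * (s + x) * q'' = (b * (s + x + y) + (\<beta> - b - 1) * y) * q' + real m * (real m + h) * q"
    using hyp_hom_ode[OF b, of "- y" "s + x + y" m "- real m - h"] unfolding q_def q'_def q''_def \<beta>_def
    by (simp add: algebra_simps)
  \<comment> \<open>\<open>U\<close> and \<open>V\<close> serve the jump from \<open>j\<close> to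
    \<open>j + 1\<close>, \<open>W\<close> and \<open>Z\<close> the reverse jump. The products of
    their left-hand prefactors are the rate numerators.\<close>
  have U: "real n * (real n + \<beta> + a) * (s + x) * p_dn = real n * (real n + \<beta> + a) * p - (\<beta> + 1) * x * p'"
    using hyp_hom_contiguous_down[OF a, of n "real n + \<beta> + a" s x] unfolding p_def p'_def p_dn_def by (simp add: algebra_simps)
  have V: "(real m + b) * (\<beta> - real m) * q_up = ((real m + b) * (\<beta> - real m) * (s + x) + (\<beta> + 1) * \<beta> * y) * q
      - (\<beta> + 1) * y * (s + x) * q'"
    using hyp_hom_contiguous_up[OF b, of m "- real m - h" "- y" "s + x + y"] unfolding q_def q'_def q_up_def \<beta>_def
    by (simp add: algebra_simps)
  have W: "real m * (real m + h) * (s + x) * q_dn = real m * (real m + h) * q + (\<beta> - 1) * y * q'"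
    using hyp_hom_contiguous_down[OF b, of m "- real m - h" "s + x + y" "- y"] unfolding q_def q'_def q_dn_def \<beta>_def
    by (simp add: algebra_simps)
  have Z: "(a + real n) * (\<beta> + real n) * p_up = ((a + real n) * (\<beta> + real n) * (s + x) + \<beta> * (\<beta> - 1) * x) * p
      + (\<beta> - 1) * x * (s + x) * p'"
    using hyp_hom_contiguous_up[OF a, of n "real n + \<beta> + a" x s] unfolding p_def p'_def p_up_def
    by (simp add: algebra_simps)
  define L where "L = x * y * (p'' * q + 2 * p' * q' + p * q'') + (a * y - b * x) * (p' * q + p * q')"
  define R where "R = Cp * (p_dn * q_up - p * q) + Cm * (p_up * q_dn - p * q)"
  have h: "h = \<beta> - 2 * real m - b" by (simp add: \<beta>_def)
  have "(s + x) * L = y * q * (x * (s + x) * p'') + x * p * (y * (s + x) * q'') + (s + x) * (2 * x * y * p' * q')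
      + (s + x) * (a * y - b * x) * (p' * q + p * q')"
    by (simp add: L_def algebra_simps)
  also have "x * (s + x) * p'' = real n * (real n + \<beta> + a) * p - (a * s + (a + \<beta> + 1) * x) * p'"
    using ode_p by simp
  finally have L: "(s + x) * L = y * q * (real n * (real n + \<beta> + a) * p - (a * s + (a + \<beta> + 1) * x) * p')
     + x * p * ((b * (s + x + y) + (\<beta> - b - 1) * y) * q' + real m * (real m + h) * q)
     + (s + x) * (2 * x * y * p' * q') + (s + x) * (a * y - b * x) * (p' * q + p * q')"
    unfolding ode_q .
  have n0: "p' = 0" if "n = 0"
    using that by (simp add: p'_def hyp_hom_deriv_def)
  have m0: "q' = 0" "q = 1" if "m = 0"
    using that by (simp_all add: q'_def q_def hyp_hom_deriv_def hyp_hom_def hom_poly_def)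
  have "(s + x) * L = (s + x) * R"
  proof (cases "m = 0")
    case True
    \<comment> \<open>\<open>\<beta> = 0\<close> is possible here, so \<open>V\<close>, which
      carries a factor \<open>\<beta>\<close>, cannot be used; the linear polynomial
      \<open>q_up\<close> is computed directly.\<close>
    then have m: "m = 0" .
    define X where "X = real n * (real n + \<beta> + a)"
    have q_up: "b * q_up = b * (s + x) + (\<beta> + 1) * y"
      using b unfolding q_up_def m hyp_hom_Suc[OF b] hyp_hom_def hom_poly_def
      by (simp add: h m hyp_coeff_def field_simps)
    have Cm: "Cm = 0"
      by (simp add: Cm_def m)
    have T1: "Cp * (s + x) * (p_dn * q_up - p) = X * p * y - x * p' * (b * (s + x) + (\<beta> + 1) * y)"
    \<comment> \<open>For \<open>n = 0\<close> the denominator \<open>\<beta> + 1\<close> may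
      vanish, but then both sides are 0.\<close>
    proof (cases "n = 0")
      case True
      then show ?thesis by (simp add: Cp_def X_def n0)
    next
      case False
      then have \<beta>1: "\<beta> + 1 \<noteq> 0" using n by auto
      then have Cp: "(\<beta> + 1) * Cp = X * b"
        by (simp add: Cp_def X_def m)
      have "(\<beta> + 1) * (Cp * (s + x) * (p_dn * q_up - p)) = X * b * ((s + x) * (p_dn * q_up - p))"
        unfolding Cp[symmetric] by (simp only: mult.assoc)
      also have "\<dots> = (X * (s + x) * p_dn) * (b * q_up) - X * b * (s + x) * p"
        by (simp add: algebra_simps)
      also have "\<dots> = (\<beta> + 1) * (X * p * y - x * p' * (b * (s + x) + (\<beta> + 1) * y))"
        unfolding U[folded X_def] q_up by (simp add: algebra_simps)
      finally show ?thesis using \<beta>1 by simp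
    qed
    have "(s + x) * R = Cp * (s + x) * (p_dn * q_up - p)"
      by (simp add: R_def Cm m0[OF m])
    also have "\<dots> = (s + x) * L"
      unfolding T1 L X_def m0[OF m] by (simp add: m algebra_simps)
    finally show ?thesis by (rule sym)
  next
    case False
    then have \<beta>: "\<beta> \<noteq> 0" "\<beta> - 1 \<noteq> 0" using m by auto
    define X E Y F where "X = real n * (real n + \<beta> + a)" and "E = (real m + b) * (\<beta> - real m)"
      and "Y = real m * (real m + h)" and "F = (a + real n) * (\<beta> + real n)"
    \<comment> \<open>In the product of \<open>U\<close> and \<open>V\<close> the terms without a
      factor \<open>\<beta> + 1\<close> cancel against \<open>X * E * (s + x) * p * q\<close>, so
      that denominator divides out. \<open>T2\<close> does the same with \<open>\<beta> - 1\<close>;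
      only \<open>\<beta>\<close> remains.\<close>
    have T1: "\<beta> * (Cp * (s + x) * (p_dn * q_up - p * q)) =
        X * p * (\<beta> * y * q - y * (s + x) * q') - x * p' * (E * (s + x) * q + (\<beta> + 1) * (\<beta> * y * q - y * (s + x) * q'))"
    proof (cases "n = 0")
      case True
      then show ?thesis by (simp add: Cp_def X_def n0)
    next
      case False
      then have \<beta>1: "\<beta> + 1 \<noteq> 0" using n by auto
      then have Cp: "(\<beta> + 1) * (\<beta> * Cp) = X * E"
        using \<open>m \<noteq> 0\<close> \<beta> by (simp add: Cp_def X_def E_def mult_ac add_ac)
      have "(\<beta> + 1) * (\<beta> * (Cp * (s + x) * (p_dn * q_up - p * q))) =
          X * E * ((s + x) * (p_dn * q_up - p * q))"
        unfolding Cp[symmetric] by (simp only: mult.assoc)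
      also have "\<dots> = (X * (s + x) * p_dn) * (E * q_up) - X * E * (s + x) * p * q"
        by (simp add: algebra_simps)
      also have "\<dots> = (\<beta> + 1) * (X * p * (\<beta> * y * q - y * (s + x) * q')
          - x * p' * (E * (s + x) * q + (\<beta> + 1) * (\<beta> * y * q - y * (s + x) * q')))"
        unfolding U[folded X_def] V[folded E_def] by (simp add: algebra_simps)
      finally show ?thesis using \<beta>1 by simp
    qed
    have T2: "\<beta> * (Cm * (s + x) * (p_up * q_dn - p * q)) =
        Y * q * (\<beta> * x * p + x * (s + x) * p') + y * q' * (F * (s + x) * p + (\<beta> - 1) * (\<beta> * x * p + x * (s + x) * p'))"
    proof -
      have Cm: "(\<beta> - 1) * (\<beta> * Cm) = Y * F"
        using \<beta> by (simp add: Cm_def Y_def F_def mult_ac add_ac)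
      have "(\<beta> - 1) * (\<beta> * (Cm * (s + x) * (p_up * q_dn - p * q))) =
          Y * F * ((s + x) * (p_up * q_dn - p * q))"
        unfolding Cm[symmetric] by (simp only: mult.assoc)
      also have "\<dots> = (Y * (s + x) * q_dn) * (F * p_up) - Y * F * (s + x) * p * q"
        by (simp add: algebra_simps)
      also have "\<dots> = (\<beta> - 1) * (Y * q * (\<beta> * x * p + x * (s + x) * p')
          + y * q' * (F * (s + x) * p + (\<beta> - 1) * (\<beta> * x * p + x * (s + x) * p')))"
        unfolding W[folded Y_def] Z[folded F_def] by (simp add: algebra_simps)
      finally show ?thesis using \<beta>(2) by simp
    qed
    have "\<beta> * ((s + x) * R) = \<beta> * (Cp * (s + x) * (p_dn * q_up - p * q)) + \<beta> * (Cm * (s + x) * (p_up * q_dn - p * q))"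
      by (simp add: R_def algebra_simps)
    also have "\<dots> = \<beta> * ((s + x) * L)"
      unfolding L T1 T2 X_def Y_def E_def F_def h by (simp add: algebra_simps)
    finally show ?thesis using \<beta>(1) by auto
  qed
  then show ?thesis using \<epsilon> unfolding L_def R_def by simp
qed

lemma continuous_on_hyp_hom [continuous_intros]:
  assumes "continuous_on S f" "continuous_on S g"
  shows "continuous_on S (\<lambda>t. hyp_hom n B c (f t) (g t))"
    "continuous_on S (\<lambda>t. hyp_hom_deriv n B c (f t) (g t))"
    "continuous_on S (\<lambda>t. hyp_hom_deriv2 n B c (f t) (g t))"
  unfolding hyp_hom_def hyp_hom_deriv_def hyp_hom_deriv2_def by (intro continuous_intros assms)+

text \<open>The rates do not depend on \<open>s\<close> and the polynomials are continuous in it, so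
  the excluded value \<open>s = -x\<close> follows by a limit. It does occur, since \<open>v\<close>
  may be negative.\<close>

lemma two_site_identity:
  fixes a b x y s h :: real and n m :: nat
  assumes a: "a > 0" and b: "b > 0"
  defines "\<beta> \<equiv> h + 2 * real m + b"
  assumes n: "n = 0 \<or> \<beta> \<noteq> -1" and m: "m = 0 \<or> \<beta> \<noteq> 0 \<and> \<beta> \<noteq> 1"
  defines "p \<equiv> hyp_hom n (real n + \<beta> + a) a x s" and "p' \<equiv> hyp_hom_deriv n (real n + \<beta> + a) a x s"
    and "p'' \<equiv> hyp_hom_deriv2 n (real n + \<beta> + a) a x s"
    and "q \<equiv> hyp_hom m (- real m - h) b (- y) (s + x + y)"
    and "q' \<equiv> hyp_hom_deriv m (- real m - h) b (- y) (s + x + y)"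
    and "q'' \<equiv> hyp_hom_deriv2 m (- real m - h) b (- y) (s + x + y)"
  defines "p_dn \<equiv> hyp_hom (n - 1) (real n + \<beta> + a + 1) a x s"
    and "p_up \<equiv> hyp_hom (Suc n) (real n + \<beta> + a - 1) a x s"
    and "q_dn \<equiv> hyp_hom (m - 1) (- real m - h + 1) b (- y) (s + x + y)"
    and "q_up \<equiv> hyp_hom (Suc m) (- real m - h - 1) b (- y) (s + x + y)"
  defines "Cp \<equiv> real n * (real m + b) * ((\<beta> + real n + a) / (\<beta> + 1)) * (if m = 0 then 1 else (\<beta> - real m) / \<beta>)"
    and "Cm \<equiv> real m * (real n + a) * (\<beta> + real n) * (h + real m) / (\<beta> * (\<beta> - 1))"
  shows "x * y * (p'' * q + 2 * p' * q' + p * q'') + (a * y - b * x) * (p' * q + p * q')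
    = Cp * (p_dn * q_up - p * q) + Cm * (p_up * q_dn - p * q)"
proof -
  define A where "A = real n + \<beta> + a"
  define B where "B = - real m - h"
  define G where "G = (\<lambda>s. x * y * (hyp_hom_deriv2 n A a x s * hyp_hom m B b (- y) (s + x + y)
        + 2 * hyp_hom_deriv n A a x s * hyp_hom_deriv m B b (- y) (s + x + y)
        + hyp_hom n A a x s * hyp_hom_deriv2 m B b (- y) (s + x + y))
      + (a * y - b * x) * (hyp_hom_deriv n A a x s * hyp_hom m B b (- y) (s + x + y)
        + hyp_hom n A a x s * hyp_hom_deriv m B b (- y) (s + x + y))
      - (Cp * (hyp_hom (n - 1) (A + 1) a x s * hyp_hom (Suc m) (B - 1) b (- y) (s + x + y)
          - hyp_hom n A a x s * hyp_hom m B b (- y) (s + x + y))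
        + Cm * (hyp_hom (Suc n) (A - 1) a x s * hyp_hom (m - 1) (B + 1) b (- y) (s + x + y)
          - hyp_hom n A a x s * hyp_hom m B b (- y) (s + x + y))))"
  have zero: "G t = 0" if "t \<noteq> - x" for t
  proof -
    have "t + x \<noteq> 0" using that by simp
    from two_site_identity_generic[OF a b this n[unfolded \<beta>_def] m[unfolded \<beta>_def]] show ?thesis
      unfolding G_def A_def B_def \<beta>_def Cp_def Cm_def right_minus_eq .
  qed
  have "continuous_on UNIV G"
    unfolding G_def by (intro continuous_intros)
  then have "(G \<longlongrightarrow> G (- x)) (at (- x))"
    by (simp add: continuous_on_def)
  moreover have "\<forall>\<^sub>F t in at (- x). G t = 0"
    unfolding eventually_at_filter by (rule always_eventually) (metis zero)
  then have "(G \<longlongrightarrow> 0) (at (- x))"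
    by (rule tendsto_eventually)
  ultimately have "G (- x) = 0"
    by (rule LIM_unique)
  with zero have "G s = 0" by (cases "s = - x") simp_all
  then show ?thesis
    unfolding G_def A_def B_def p_def p'_def p''_def q_def q'_def q''_def p_dn_def p_up_def q_dn_def q_up_def
      right_minus_eq .
qed

section \<open>Derivatives along energy exchange\<close>

text \<open>\<open>\<Phi>'\<close> is the directional derivative \<open>\<partial>\<^sub>1 \<Phi> - \<partial>\<^sub>2 \<Phi>\<close>.\<close>

definition exchange_deriv :: "(real \<Rightarrow> real \<Rightarrow> real) \<Rightarrow> (real \<Rightarrow> real \<Rightarrow> real) \<Rightarrow> bool" where
  "exchange_deriv \<Phi> \<Phi>' \<longleftrightarrow> (\<forall>x y. \<exists>d1 d2. ((\<lambda>t. \<Phi> t y) has_real_derivative d1) (at x) \<and>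
     ((\<lambda>t. \<Phi> x t) has_real_derivative d2) (at y) \<and> \<Phi>' x y = d1 - d2)"

lemma exchange_deriv_mult:
  assumes "exchange_deriv f f'" "exchange_deriv g g'"
  shows "exchange_deriv (\<lambda>x y. f x y * g x y) (\<lambda>x y. f' x y * g x y + f x y * g' x y)"
  unfolding exchange_deriv_def
proof (intro allI)
  fix x y
  obtain d1 d2 where f: "((\<lambda>t. f t y) has_real_derivative d1) (at x)"
    "((\<lambda>t. f x t) has_real_derivative d2) (at y)" "f' x y = d1 - d2"
    using assms(1) unfolding exchange_deriv_def by blast
  obtain e1 e2 where g: "((\<lambda>t. g t y) has_real_derivative e1) (at x)"
    "((\<lambda>t. g x t) has_real_derivative e2) (at y)" "g' x y = e1 - e2"
    using assms(2) unfolding exchange_deriv_def by blast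
  show "\<exists>d1 d2. ((\<lambda>t. f t y * g t y) has_real_derivative d1) (at x) \<and>
     ((\<lambda>t. f x t * g x t) has_real_derivative d2) (at y) \<and> f' x y * g x y + f x y * g' x y = d1 - d2"
    by (intro exI conjI, rule DERIV_mult[OF f(1) g(1)], rule DERIV_mult[OF f(2) g(2)])
      (simp add: f g algebra_simps)
qed

lemma exchange_deriv_add:
  assumes "exchange_deriv f f'" "exchange_deriv g g'"
  shows "exchange_deriv (\<lambda>x y. f x y + g x y) (\<lambda>x y. f' x y + g' x y)"
  unfolding exchange_deriv_def
proof (intro allI)
  fix x y
  obtain d1 d2 where f: "((\<lambda>t. f t y) has_real_derivative d1) (at x)"
    "((\<lambda>t. f x t) has_real_derivative d2) (at y)" "f' x y = d1 - d2"
    using assms(1) unfolding exchange_deriv_def by blast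
  obtain e1 e2 where g: "((\<lambda>t. g t y) has_real_derivative e1) (at x)"
    "((\<lambda>t. g x t) has_real_derivative e2) (at y)" "g' x y = e1 - e2"
    using assms(2) unfolding exchange_deriv_def by blast
  show "\<exists>d1 d2. ((\<lambda>t. f t y + g t y) has_real_derivative d1) (at x) \<and>
     ((\<lambda>t. f x t + g x t) has_real_derivative d2) (at y) \<and> f' x y + g' x y = d1 - d2"
    by (intro exI conjI, rule DERIV_add[OF f(1) g(1)], rule DERIV_add[OF f(2) g(2)])
      (simp add: f g)
qed

lemma exchange_deriv_sum:
  assumes "\<And>i. i \<in> A \<Longrightarrow> exchange_deriv (f i) (f' i)"
  shows "exchange_deriv (\<lambda>x y. \<Sum>i\<in>A. f i x y) (\<lambda>x y. \<Sum>i\<in>A. f' i x y)"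
proof -
  have const: "exchange_deriv (\<lambda>x y. 0) (\<lambda>x y. 0)"
    unfolding exchange_deriv_def by (auto intro!: exI[of _ 0])
  show ?thesis
  proof (cases "finite A")
    case True
    then show ?thesis using assms
      by (induction A rule: finite_induct) (auto intro!: const exchange_deriv_add)
  qed (simp add: const)
qed

lemma exchange_deriv_fst:
  assumes "\<And>x. (f has_real_derivative f' x) (at x)"
  shows "exchange_deriv (\<lambda>x y. f x) (\<lambda>x y. f' x)"
  unfolding exchange_deriv_def using assms by (metis DERIV_const diff_zero)

lemma exchange_deriv_snd:
  assumes "\<And>x. (f has_real_derivative f' x) (at x)"
  shows "exchange_deriv (\<lambda>x y. f y) (\<lambda>x y. - f' y)"
  unfolding exchange_deriv_def using assms by (metis DERIV_const diff_0)

text \<open>The total is conserved under exchange; this makes the remaining factors act as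
  constants.\<close>

lemma exchange_deriv_total:
  assumes "\<And>t. (r has_real_derivative r' t) (at t)"
  shows "exchange_deriv (\<lambda>x y. r (x + y)) (\<lambda>x y. 0)"
  unfolding exchange_deriv_def
proof (intro allI exI conjI)
  fix x y
  show "((\<lambda>t. r (t + y)) has_real_derivative r' (x + y)) (at x)"
    using DERIV_shift[of r "r' (x + y)" x y] assms by (simp add: add.commute)
  show "((\<lambda>t. r (x + t)) has_real_derivative r' (x + y)) (at y)"
    using DERIV_shift[of r "r' (x + y)" y x] assms by (simp add: add.commute)
qed simp

text \<open>The second argument depends on the total only, and the sign of \<open>- y\<close>
  cancels the sign of the second partial derivative.\<close>

lemma exchange_deriv_hyp_hom:
  "exchange_deriv (\<lambda>x y. hyp_hom n B c (- y) (s + x + y)) (\<lambda>x y. hyp_hom_deriv n B c (- y) (s + x + y))"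
proof -
  let ?a = "hyp_coeff n B c"
  have "exchange_deriv (\<lambda>x y. \<Sum>i\<le>n. (?a i * (- y) ^ i) * (s + (x + y)) ^ (n - i))
    (\<lambda>x y. \<Sum>i\<le>n. - (- (?a i * (real i * (- y) ^ (i - 1)))) * (s + (x + y)) ^ (n - i) + (?a i * (- y) ^ i) * 0)"
    by (intro exchange_deriv_sum exchange_deriv_mult exchange_deriv_snd
        exchange_deriv_total[of "\<lambda>t. (s + t) ^ (n - i)" "\<lambda>t. real (n - i) * (s + t) ^ (n - i - 1)" for i])
      (auto intro!: derivative_eq_intros)
  \<comment> \<open>The left side is the raw output of the product rule; it is identified by
    uniqueness of the derivative in \<open>z\<close>.\<close>
  moreover have "(\<Sum>i\<le>n. - (- (?a i * (real i * z ^ (i - 1)))) * \<sigma> ^ (n - i) + (?a i * z ^ i) * 0)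
      = hyp_hom_deriv n B c z \<sigma>" for z \<sigma>
  proof (rule DERIV_unique[OF _ hyp_hom_has_deriv])
    show "((\<lambda>x. hyp_hom n B c x \<sigma>) has_real_derivative
      (\<Sum>i\<le>n. - (- (?a i * (real i * z ^ (i - 1)))) * \<sigma> ^ (n - i) + (?a i * z ^ i) * 0)) (at z)"
      unfolding hyp_hom_def hom_poly_def
      by (auto intro!: derivative_eq_intros simp del: sum.atMost_Suc simp: mult_ac)
  qed
  ultimately show ?thesis
    by (simp add: hyp_hom_def hom_poly_def add.assoc)
qed

text \<open>Agreement on the closed quadrant suffices for the one-sided derivatives. The conclusion
  has the shape of the first hypothesis, so the lemma can be iterated for second order.\<close>

lemma partial_diff_eq_exchange_deriv:
  assumes f: "\<And>x x'. x \<ge> 0 \<Longrightarrow> x' \<ge> 0 \<Longrightarrow> f (y(j := x, Suc j := x')) = \<Phi> x x'"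
    and \<Phi>: "exchange_deriv \<Phi> \<Phi>'" and "x \<ge> 0" "x' \<ge> 0"
  shows "partial_diff j f (y(j := x, Suc j := x')) = \<Phi>' x x'"
proof -
  have vd: "vector_derivative g (at z within {0..}) = d"
    if "z \<ge> 0" "(G has_real_derivative d) (at z)" "\<And>t. t \<ge> 0 \<Longrightarrow> g t = G t" for g G :: "real \<Rightarrow> real" and z d
  proof (rule vector_derivative_within)
    have "z islimpt {0..}"
      by (rule islimpt_subset[OF islimpt_greaterThanLessThan1[of z "z + 1"]]) (use \<open>z \<ge> 0\<close> in auto)
    then show "at z within {0..} \<noteq> bot"
      by (simp add: trivial_limit_within)
    have "(G has_vector_derivative d) (at z within {0..})"
      using that(2) by (simp add: has_real_derivative_iff_has_vector_derivative has_vector_derivative_at_within)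
    then show "(g has_vector_derivative d) (at z within {0..})"
      by (rule has_vector_derivative_transform[rotated 2]) (use that in auto)
  qed
  obtain d1 d2 where d: "((\<lambda>t. \<Phi> t x') has_real_derivative d1) (at x)"
    "((\<lambda>t. \<Phi> x t) has_real_derivative d2) (at x')" "\<Phi>' x x' = d1 - d2"
    using \<Phi> unfolding exchange_deriv_def by blast
  have "y(j := x, Suc j := x', j := t) = y(j := t, Suc j := x')" for t
    by auto
  then have "partial_deriv j f (y(j := x, Suc j := x')) = d1"
    unfolding partial_deriv_def using d(1) assms by (intro vd) simp_all
  moreover have "partial_deriv (Suc j) f (y(j := x, Suc j := x')) = d2"
    unfolding partial_deriv_def using d(2) assms by (intro vd) simp_all
  ultimately show ?thesis unfolding partial_diff_def by (simp add: d)
qed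

section \<open>Duality\<close>

lemma height_R_rec:
  assumes "j \<le> M"
  shows "height_R M k \<rho> j \<xi> = 2 * real (\<xi> j) + k j + height_R M k \<rho> (Suc j) \<xi>"
  using assms by (simp add: height_R_def sum.atLeast_Suc_atMost)

text \<open>If \<open>\<rho> > -1\<close>, then \<open>\<beta> > 2 \<xi> (j + 1) - 1\<close>.
  Otherwise the height at site 1 is negative, hence so is the one at \<open>j\<close>, and
  \<open>\<beta> < -2 \<xi> j\<close>.\<close>

lemma height_R_nondegenerate:
  assumes k: "\<And>j. j \<in> {1..M} \<Longrightarrow> k j > 0" and j: "1 \<le> j" "j < M"
    and \<xi>: "\<xi> \<in> SIP_R_space M k \<rho>"
  defines "\<beta> \<equiv> height_R M k \<rho> (Suc j) \<xi>"
  shows "\<xi> j = 0 \<or> \<beta> \<noteq> -1" "\<xi> (Suc j) = 0 \<or> \<beta> \<noteq> 0 \<and> \<beta> \<noteq> 1"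
proof -
  have pos: "(\<Sum>i\<in>A. 2 * real (\<xi> i) + k i) \<ge> 0" if "A \<subseteq> {1..M}" for A
    using that k by (intro sum_nonneg add_nonneg_nonneg) (auto simp: less_imp_le subset_eq)
  have "(\<xi> j = 0 \<or> \<beta> \<noteq> -1) \<and> (\<xi> (Suc j) = 0 \<or> \<beta> \<noteq> 0 \<and> \<beta> \<noteq> 1)"
  proof (cases "\<rho> > -1")
    case True
    have "height_R M k \<rho> (Suc (Suc j)) \<xi> \<ge> \<rho>"
      using pos[of "{Suc (Suc j)..M}"] by (simp add: height_R_def)
    moreover have "k (Suc j) > 0" using k j by simp
    ultimately have "\<beta> > 2 * real (\<xi> (Suc j)) - 1"
      using True j unfolding \<beta>_def by (subst height_R_rec) auto
    then show ?thesis by (cases "\<xi> (Suc j)") auto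
  next
    case False
    then have "2 * real (\<Sum>j\<in>{1..M}. \<xi> j) + (\<Sum>j\<in>{1..M}. k j) + \<rho> < 0"
      using \<xi> by (simp add: SIP_R_space_def)
    then have "height_R M k \<rho> 1 \<xi> < 0"
      by (simp add: height_R_def sum.distrib sum_distrib_left)
    moreover have "height_R M k \<rho> 1 \<xi> = height_R M k \<rho> j \<xi> + (\<Sum>i\<in>{1..<j}. 2 * real (\<xi> i) + k i)"
    proof -
      have "{1..M} = {1..<j} \<union> {j..M}" using j by auto
      then show ?thesis by (simp add: height_R_def sum.union_disjoint ivl_disj_int del: One_nat_def)
    qed
    moreover have sub: "{1..<j} \<subseteq> {1..M}" using j by auto
    ultimately have "height_R M k \<rho> j \<xi> < 0"
      using pos[OF sub] by linarith
    moreover have "k j > 0" using k j by simp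
    ultimately have "\<beta> < - 2 * real (\<xi> j)"
      using j unfolding \<beta>_def by (subst (asm) height_R_rec) auto
    then show ?thesis by (cases "\<xi> j") auto
  qed
  then show "\<xi> j = 0 \<or> \<beta> \<noteq> -1" "\<xi> (Suc j) = 0 \<or> \<beta> \<noteq> 0 \<and> \<beta> \<noteq> 1" by auto
qed

lemma E_minus_exchange:
  assumes "1 \<le> j"
  shows "l < j \<Longrightarrow> E_minus l (y(j := x, Suc j := x')) = E_minus l y"
    and "E_minus j (y(j := x, Suc j := x')) = E_minus (j - 1) y + x"
    and "j < l \<Longrightarrow> E_minus l (y(j := x, Suc j := x')) = E_minus (j - 1) y + x + x' + (\<Sum>i\<in>{Suc (Suc j)..l}. y i)"
proof -
  show lt: "E_minus l (y(j := x, Suc j := x')) = E_minus l y" if "l < j" for l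
    unfolding E_minus_def using that by (intro sum.cong) auto
  have E_Suc: "E_minus (Suc l) z = E_minus l z + z (Suc l)" for l z
    by (simp add: E_minus_def)
  show eq: "E_minus j (y(j := x, Suc j := x')) = E_minus (j - 1) y + x"
    using assms E_Suc[of "j - 1" "y(j := x, Suc j := x')"] lt[of "j - 1"] by simp
  show "E_minus l (y(j := x, Suc j := x')) = E_minus (j - 1) y + x + x' + (\<Sum>i\<in>{Suc (Suc j)..l}. y i)" if "j < l"
    using that
  proof (induction l)
    case (Suc l)
    show ?case
    proof (cases "l = j")
      case True
      show ?thesis unfolding True E_Suc eq by simp
    next
      case False
      then show ?thesis using Suc by (simp add: E_Suc)
    qed
  qed simp
qed

section \<open>Separation of the factors at two neighbouring sites\<close>

definition dual_rest ::
    "nat \<Rightarrow> (nat \<Rightarrow> real) \<Rightarrow> real \<Rightarrow> real \<Rightarrow> (nat \<Rightarrow> nat) \<Rightarrow> nat \<Rightarrow> (nat \<Rightarrow> real) \<Rightarrow> real" where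
  "dual_rest M k \<rho> v \<xi> j y = (\<Prod>i\<in>{1..M} - {j, Suc j}. dual_factor M k \<rho> v \<xi> i y)"

lemma duality_P_split:
  assumes "\<And>j. j \<in> {1..M} \<Longrightarrow> k j > 0" "1 \<le> j" "j < M"
  shows "duality_P M k \<rho> v y \<xi> =
    dual_rest M k \<rho> v \<xi> j y * (dual_factor M k \<rho> v \<xi> j y * dual_factor M k \<rho> v \<xi> (Suc j) y)"
proof -
  have "{1..M} = insert j (insert (Suc j) ({1..M} - {j, Suc j}))" using assms by auto
  then have "(\<Prod>i\<in>{1..M}. f i) = f j * (f (Suc j) * (\<Prod>i\<in>{1..M} - {j, Suc j}. f i))" for f :: "nat \<Rightarrow> real"
    by (metis (no_types, lifting) Diff_iff finite_Diff finite_atLeastAtMost finite_insert insertCI insert_iff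
        n_not_Suc_n prod.insert)
  moreover have "duality_P M k \<rho> v y \<xi> = duality_P_hyp M k \<rho> v y \<xi>"
    using assms(1) by (rule duality_P_eq_hyp)
  ultimately show ?thesis
    unfolding duality_P_hyp_eq dual_rest_def by (simp only: mult_ac)
qed

text \<open>A jump between \<open>j\<close> and \<open>j + 1\<close> changes only the height at
  \<open>j + 1\<close>, and only the factor at \<open>j\<close> contains that height.\<close>

lemma dual_rest_cong:
  assumes "1 \<le> j" "j < M" and "\<And>i. i \<noteq> j \<Longrightarrow> i \<noteq> Suc j \<Longrightarrow> \<eta> i = \<xi> i" and "\<eta> j + \<eta> (Suc j) = \<xi> j + \<xi> (Suc j)"
  shows "dual_rest M k \<rho> v \<eta> j y = dual_rest M k \<rho> v \<xi> j y"
proof -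
  have eq: "height_R M k \<rho> i \<eta> = height_R M k \<rho> i \<xi>" if "Suc j < i" for i
    unfolding height_R_def using that assms(3) by (intro arg_cong2[of _ _ _ _ "(+)"] sum.cong) auto
  have "real (\<eta> j) + real (\<eta> (Suc j)) = real (\<xi> j) + real (\<xi> (Suc j))"
    using assms(4) by linarith
  then have j: "height_R M k \<rho> j \<eta> = height_R M k \<rho> j \<xi>"
    using assms(1,2) eq[of "Suc (Suc j)"] by (simp add: height_R_rec)
  have "height_R M k \<rho> i \<eta> = height_R M k \<rho> i \<xi>" if "i \<le> j" for i
    using that
  proof (induction rule: inc_induct)
    case (step i)
    then show ?case using assms by (simp add: height_R_rec)
  qed (rule j)
  with eq have "height_R M k \<rho> (i + 1) \<eta> = height_R M k \<rho> (i + 1) \<xi>" if "i \<noteq> j" "i \<noteq> Suc j" for i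
    using that by (metis Suc_eq_plus1 Suc_leI linorder_neqE_nat not_less_eq)
  then show ?thesis
    unfolding dual_rest_def dual_factor_def using assms(3) by (intro prod.cong) auto
qed

text \<open>The partial energies in these factors involve \<open>x\<close> and \<open>x'\<close>
  through their sum or not at all; placing the sum at site \<open>j\<close> gives a function of one
  variable.\<close>

lemma dual_rest_exchange:
  assumes "1 \<le> j"
  shows "dual_rest M k \<rho> v \<xi> j (y(j := x, Suc j := x')) = dual_rest M k \<rho> v \<xi> j (y(j := x + x', Suc j := 0))"
  unfolding dual_rest_def
proof (rule prod.cong)
  fix i assume i: "i \<in> {1..M} - {j, Suc j}"
  then have "i - 1 < j \<or> j < i - 1" by auto
  then have "E_minus (i - 1) (y(j := x, Suc j := x')) = E_minus (i - 1) (y(j := x + x', Suc j := 0))"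
    using E_minus_exchange(1,3)[OF assms] by auto
  then show "dual_factor M k \<rho> v \<xi> i (y(j := x, Suc j := x')) = dual_factor M k \<rho> v \<xi> i (y(j := x + x', Suc j := 0))"
    using i by (simp add: dual_factor_def)
qed simp

lemma differentiable_prod:
  fixes f :: "'i \<Rightarrow> real \<Rightarrow> real"
  assumes "\<And>i. i \<in> A \<Longrightarrow> f i differentiable (at t)"
  shows "(\<lambda>t. \<Prod>i\<in>A. f i t) differentiable (at t)"
  using assms by (induction A rule: infinite_finite_induct) (auto intro!: derivative_intros)

text \<open>Existence is enough: the derivative drops out by
  \<open>exchange_deriv_total\<close>.\<close>

lemma dual_rest_differentiable:
  assumes "1 \<le> j"
  shows "\<exists>r'. \<forall>t. ((\<lambda>t. dual_rest M k \<rho> v \<xi> j (y(j := t, Suc j := 0))) has_real_derivative r' t) (at t)"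
proof -
  have "(\<lambda>t. dual_factor M k \<rho> v \<xi> i (y(j := t, Suc j := 0))) differentiable (at t)"
    if i: "i \<in> {1..M} - {j, Suc j}" for i t
  proof -
    have E: "(\<lambda>t. E_minus (i - 1) (y(j := t, Suc j := 0))) differentiable (at t)"
      using E_minus_exchange(1,3)[OF assms, of "i - 1"] i
      by (cases "i - 1 < j") (auto intro!: derivative_intros)
    have "(y(j := t, Suc j := 0)) i = y i" for t using i by simp
    then show ?thesis
      unfolding dual_factor_def hyp_hom_def hom_poly_def
      by (auto intro!: derivative_intros E simp del: sum.atMost_Suc One_nat_def)
  qed
  then have "(\<lambda>t. dual_rest M k \<rho> v \<xi> j (y(j := t, Suc j := 0))) differentiable (at t)" for t
    unfolding dual_rest_def by (rule differentiable_prod)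
  then show ?thesis by (metis real_differentiable_def)
qed

text \<open>Pfaff's transformation at site \<open>j + 1\<close> turns the second parameter into
  \<open>c - B\<close>, in which \<open>k (j + 1)\<close> cancels.\<close>

lemma dual_factor_pair:
  assumes "1 \<le> j" "j < M" "k (Suc j) > 0"
  shows "dual_factor M k \<rho> v \<xi> j (y(j := x, Suc j := x')) =
      hyp_hom (\<xi> j) (real (\<xi> j) + height_R M k \<rho> (Suc j) \<xi> + k j) (k j) x (v + E_minus (j - 1) y)"
    and "dual_factor M k \<rho> v \<xi> (Suc j) (y(j := x, Suc j := x')) =
      hyp_hom (\<xi> (Suc j)) (- real (\<xi> (Suc j)) - height_R M k \<rho> (Suc (Suc j)) \<xi>) (k (Suc j)) (- x')
        (v + E_minus (j - 1) y + x + x')"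
  using assms E_minus_exchange(1,2)[OF assms(1)]
  by (simp_all add: dual_factor_def add.assoc hyp_hom_pfaff[OF assms(3), of _ _ x'])

text \<open>Duality holds bond by bond, which is stronger than equality of the two sums.\<close>

lemma generator_terms_eq:
  fixes v :: real
  assumes k: "\<And>j. j \<in> {1..M} \<Longrightarrow> k j > 0" and y: "y \<in> energy_space M" and \<xi>: "\<xi> \<in> SIP_R_space M k \<rho>"
    and j: "1 \<le> j" "j < M"
  defines "D \<equiv> duality_P M k \<rho> v"
  shows "y j * y (j + 1) * partial_diff j (partial_diff j (\<lambda>y. D y \<xi>)) y
        + (k j * y (j + 1) - k (j + 1) * y j) * partial_diff j (\<lambda>y. D y \<xi>) y
    = rate_plus M k \<rho> j \<xi> * (D y (move j (j + 1) \<xi>) - D y \<xi>)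
        + rate_minus M k \<rho> (j + 1) \<xi> * (D y (move (j + 1) j \<xi>) - D y \<xi>)"
proof -
  define n m where "n = \<xi> j" and "m = \<xi> (Suc j)"
  define a b where "a = k j" and "b = k (Suc j)"
  define h \<beta> where "h = height_R M k \<rho> (Suc (Suc j)) \<xi>" and "\<beta> = height_R M k \<rho> (Suc j) \<xi>"
  define s where "s = v + E_minus (j - 1) y"
  have ab: "a > 0" "b > 0" using k j by (auto simp: a_def b_def)
  have \<beta>: "\<beta> = h + 2 * real m + b"
    using j by (simp add: \<beta>_def h_def m_def b_def height_R_rec)
  have pos: "y j \<ge> 0" "y (Suc j) \<ge> 0"
    using y j by (auto simp: energy_space_def PiE_iff)
  have y_upd: "y(j := y j, Suc j := y (Suc j)) = y" by simp
  define A B where "A = real n + \<beta> + a" and "B = - real m - h"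
  define p p' p'' where "p = (\<lambda>x. hyp_hom n A a x s)" and "p' = (\<lambda>x. hyp_hom_deriv n A a x s)"
    and "p'' = (\<lambda>x. hyp_hom_deriv2 n A a x s)"
  define q q' q'' where "q = (\<lambda>x x'. hyp_hom m B b (- x') (s + x + x'))"
    and "q' = (\<lambda>x x'. hyp_hom_deriv m B b (- x') (s + x + x'))"
    and "q'' = (\<lambda>x x'. hyp_hom_deriv2 m B b (- x') (s + x + x'))"
  define r where "r = (\<lambda>t. dual_rest M k \<rho> v \<xi> j (y(j := t, Suc j := 0)))"
  have split: "D z \<eta> =
      dual_rest M k \<rho> v \<eta> j z * (dual_factor M k \<rho> v \<eta> j z * dual_factor M k \<rho> v \<eta> (Suc j) z)" for z \<eta>
    unfolding D_def using k j by (rule duality_P_split)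
  have split_\<xi>: "D (y(j := x, Suc j := x')) \<xi> = r (x + x') * (p x * q x x')" for x x'
    unfolding split dual_factor_pair[OF j, of k, folded b_def, OF ab(2)] dual_rest_exchange[OF j(1), of _ _ _ _ _ _ x]
      r_def p_def q_def A_def B_def a_def b_def n_def m_def h_def \<beta>_def s_def by simp
  obtain r' where r': "\<And>t. (r has_real_derivative r' t) (at t)"
    using dual_rest_differentiable[OF j(1)] unfolding r_def by blast
  have ed_r: "exchange_deriv (\<lambda>x x'. r (x + x')) (\<lambda>x x'. 0)"
    using r' by (rule exchange_deriv_total)
  have ed_p: "exchange_deriv (\<lambda>x x'. p x) (\<lambda>x x'. p' x)"
    unfolding p_def p'_def by (intro exchange_deriv_fst hyp_hom_has_deriv)
  have ed_p': "exchange_deriv (\<lambda>x x'. p' x) (\<lambda>x x'. p'' x)"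
    unfolding p'_def p''_def hyp_hom_deriv2_def hyp_hom_deriv_def[of n]
    by (intro exchange_deriv_fst DERIV_cmult hyp_hom_has_deriv)
  have ed_q: "exchange_deriv q q'"
    unfolding q_def q'_def by (rule exchange_deriv_hyp_hom)
  have ed_q': "exchange_deriv q' q''"
  proof -
    have const: "exchange_deriv (\<lambda>x x'. c) (\<lambda>x x'. 0)" for c
      by (rule exchange_deriv_fst) simp
    have "exchange_deriv (\<lambda>x x'. c * hyp_hom (m - 1) (B + 1) (b + 1) (- x') (s + x + x'))
      (\<lambda>x x'. 0 * hyp_hom (m - 1) (B + 1) (b + 1) (- x') (s + x + x')
        + c * hyp_hom_deriv (m - 1) (B + 1) (b + 1) (- x') (s + x + x'))" for c
      by (intro exchange_deriv_mult const exchange_deriv_hyp_hom)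
    then show ?thesis
      unfolding q'_def q''_def hyp_hom_deriv2_def hyp_hom_deriv_def[of m] by (simp only: mult_zero_left add_0)
  qed
  define \<Phi>1 where "\<Phi>1 = (\<lambda>x x'. r (x + x') * (p' x * q x x' + p x * q' x x'))"
  define \<Phi>2 where "\<Phi>2 = (\<lambda>x x'. r (x + x') * (p'' x * q x x' + 2 * p' x * q' x x' + p x * q'' x x'))"
  have "exchange_deriv (\<lambda>x x'. r (x + x') * (p x * q x x')) \<Phi>1"
    using exchange_deriv_mult[OF ed_r exchange_deriv_mult[OF ed_p ed_q]] by (simp add: \<Phi>1_def)
  note ed_\<Phi>1 = this
  have D1: "partial_diff j (\<lambda>y. D y \<xi>) (y(j := x, Suc j := x')) = \<Phi>1 x x'" if "x \<ge> 0" "x' \<ge> 0" for x x'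
    by (rule partial_diff_eq_exchange_deriv[where f = "\<lambda>y. D y \<xi>" and y = y and j = j, OF split_\<xi> ed_\<Phi>1 that])
  have "exchange_deriv \<Phi>1 \<Phi>2"
    using exchange_deriv_mult[OF ed_r exchange_deriv_add[OF exchange_deriv_mult[OF ed_p' ed_q] exchange_deriv_mult[OF ed_p ed_q']]]
    by (simp add: \<Phi>1_def \<Phi>2_def algebra_simps)
  note ed_\<Phi>2 = this
  \<comment> \<open>\<open>D1\<close> holds on the whole quadrant, so it can serve as the hypothesis
    for the second derivative.\<close>
  have D2: "partial_diff j (partial_diff j (\<lambda>y. D y \<xi>)) (y(j := x, Suc j := x')) = \<Phi>2 x x'"
    if "x \<ge> 0" "x' \<ge> 0" for x x'
    by (rule partial_diff_eq_exchange_deriv[where f = "partial_diff j (\<lambda>y. D y \<xi>)" and y = y and j = j, OF D1 ed_\<Phi>2 that])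
  define x x' where "x = y j" and "x' = y (Suc j)"
  define p_dn p_up where "p_dn = hyp_hom (n - 1) (A + 1) a x s" and "p_up = hyp_hom (Suc n) (A - 1) a x s"
  define q_dn q_up where "q_dn = hyp_hom (m - 1) (B + 1) b (- x') (s + x + x')"
    and "q_up = hyp_hom (Suc m) (B - 1) b (- x') (s + x + x')"
  \<comment> \<open>Moving one particle from \<open>j\<close> to \<open>j + 1\<close> turns
    \<open>(A, B)\<close> into \<open>(A + 1, B - 1)\<close>, the reverse move into
    \<open>(A - 1, B + 1)\<close>: the shifts of the contiguous relations.\<close>
  have move_split: "D y \<eta> = r (x + x') * (hyp_hom n1 A1 a x s * hyp_hom m1 B1 b (- x') (s + x + x'))"
    if \<eta>: "\<And>i. i \<noteq> j \<Longrightarrow> i \<noteq> Suc j \<Longrightarrow> \<eta> i = \<xi> i" "\<eta> j = n1" "\<eta> (Suc j) = m1" "n1 + m1 = n + m"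
      and A1: "A1 = real n1 + (h + 2 * real m1 + b) + a" and B1: "B1 = - real m1 - h" for \<eta> n1 m1 A1 B1
  proof -
    have h: "height_R M k \<rho> (Suc (Suc j)) \<eta> = h"
      unfolding h_def height_R_def using \<eta>(1) by (intro arg_cong2[of _ _ _ _ "(+)"] sum.cong) auto
    then have \<beta>1: "height_R M k \<rho> (Suc j) \<eta> = h + 2 * real m1 + b"
      using j \<eta>(3) by (simp add: height_R_rec b_def)
    have "D y \<eta> = D (y(j := x, Suc j := x')) \<eta>" unfolding x_def x'_def y_upd ..
    also have "\<dots> = dual_rest M k \<rho> v \<eta> j (y(j := x + x', Suc j := 0)) *
        (hyp_hom n1 A1 a x s * hyp_hom m1 B1 b (- x') (s + x + x'))"
      unfolding split dual_factor_pair[OF j, of k, folded b_def, OF ab(2)] dual_rest_exchange[OF j(1), of _ _ _ _ _ _ x]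
        \<eta>(2,3) h \<beta>1 A1 B1 a_def b_def s_def by simp
    also have "dual_rest M k \<rho> v \<eta> j (y(j := x + x', Suc j := 0)) = r (x + x')"
      unfolding r_def using \<eta> by (intro dual_rest_cong j) (auto simp: n_def m_def)
    finally show ?thesis .
  qed
  have plus: "rate_plus M k \<rho> j \<xi> * (D y (move j (j + 1) \<xi>) - D y \<xi>) =
      rate_plus M k \<rho> j \<xi> * (r (x + x') * (p_dn * q_up) - r (x + x') * (p x * q x x'))"
  \<comment> \<open>At an empty site the rate is 0, so the value of \<open>p_dn\<close> with
    truncated \<open>n - 1\<close> is irrelevant.\<close>
  proof (cases "n = 0")
    case False
    have "D y (move j (j + 1) \<xi>) = r (x + x') * (p_dn * q_up)"
      unfolding p_dn_def q_up_def
      by (rule move_split) (use False in \<open>auto simp: move_def n_def[symmetric] m_def[symmetric] A_def B_def \<beta> of_nat_diff\<close>)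
    then show ?thesis using split_\<xi>[of x x'] by (simp add: x_def x'_def)
  qed (simp add: rate_plus_def n_def)
  have minus: "rate_minus M k \<rho> (j + 1) \<xi> * (D y (move (j + 1) j \<xi>) - D y \<xi>) =
      rate_minus M k \<rho> (j + 1) \<xi> * (r (x + x') * (p_up * q_dn) - r (x + x') * (p x * q x x'))"
  proof (cases "m = 0")
    case False
    have "D y (move (j + 1) j \<xi>) = r (x + x') * (p_up * q_dn)"
      unfolding p_up_def q_dn_def
      by (rule move_split) (use False in \<open>auto simp: move_def n_def[symmetric] m_def[symmetric] A_def B_def \<beta> of_nat_diff\<close>)
    then show ?thesis using split_\<xi>[of x x'] by (simp add: x_def x'_def)
  qed (simp add: rate_minus_def m_def)
  define Cp where "Cp = real n * (real m + b) * ((\<beta> + real n + a) / (\<beta> + 1)) * (if m = 0 then 1 else (\<beta> - real m) / \<beta>)"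
  define Cm where "Cm = real m * (real n + a) * (\<beta> + real n) * (h + real m) / (\<beta> * (\<beta> - 1))"
  \<comment> \<open>The height at \<open>j\<close> is \<open>\<beta> + 2 n + a\<close>; subtracting
    \<open>n\<close> gives the factor \<open>\<beta> + n + a\<close>.\<close>
  have rate_p: "rate_plus M k \<rho> j \<xi> = Cp"
    using j by (simp add: rate_plus_def Let_def Cp_def n_def m_def a_def b_def \<beta>_def height_R_rec[of j] algebra_simps)
  have rate_m: "rate_minus M k \<rho> (j + 1) \<xi> = Cm"
    by (simp add: rate_minus_def Let_def Cm_def n_def m_def a_def b_def \<beta>_def h_def)
  have nondeg: "n = 0 \<or> h + 2 * real m + b \<noteq> -1" "m = 0 \<or> h + 2 * real m + b \<noteq> 0 \<and> h + 2 * real m + b \<noteq> 1"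
    using height_R_nondegenerate[OF _ j \<xi>] k unfolding \<beta>_def[symmetric] n_def[symmetric] m_def[symmetric] \<beta> by blast+
  have key: "x * x' * (p'' x * q x x' + 2 * p' x * q' x x' + p x * q'' x x') + (a * x' - b * x) * (p' x * q x x' + p x * q' x x')
    = Cp * (p_dn * q_up - p x * q x x') + Cm * (p_up * q_dn - p x * q x x')"
    unfolding p_def p'_def p''_def q_def q'_def q''_def p_dn_def p_up_def q_dn_def q_up_def Cp_def Cm_def A_def B_def \<beta>
    by (rule two_site_identity[OF ab nondeg])
  have "y j * y (j + 1) * partial_diff j (partial_diff j (\<lambda>y. D y \<xi>)) y
        + (k j * y (j + 1) - k (j + 1) * y j) * partial_diff j (\<lambda>y. D y \<xi>) y
    = r (x + x') * (x * x' * (p'' x * q x x' + 2 * p' x * q' x x' + p x * q'' x x')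
        + (a * x' - b * x) * (p' x * q x x' + p x * q' x x'))"
    using D1[OF pos] D2[OF pos] unfolding y_upd by (simp add: \<Phi>1_def \<Phi>2_def x_def x'_def a_def b_def algebra_simps)
  also have "\<dots> = r (x + x') * (Cp * (p_dn * q_up - p x * q x x') + Cm * (p_up * q_dn - p x * q x x'))"
    by (simp only: key)
  also have "\<dots> = rate_plus M k \<rho> j \<xi> * (D y (move j (j + 1) \<xi>) - D y \<xi>)
        + rate_minus M k \<rho> (j + 1) \<xi> * (D y (move (j + 1) j \<xi>) - D y \<xi>)"
    unfolding plus minus unfolding rate_p rate_m by (simp only: distrib_left right_diff_distrib mult_ac)
  finally show ?thesis .
qed

theorem proposition4p12:
  fixes M :: nat and k :: "nat \<Rightarrow> real" and \<rho> v :: real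
  assumes "\<And>j. j \<in> {1..M} \<Longrightarrow> k j > 0"
  shows "(\<forall>y\<in>energy_space M. \<forall>\<xi>\<in>SIP_R_space M k \<rho>.
            duality_P M k \<rho> v y \<xi> = duality_P_hyp M k \<rho> v y \<xi>) \<and>
         generator_duality (L_BEP M k) (energy_space M)
           (L_SIP_R M k \<rho>) (SIP_R_space M k \<rho>) (duality_P M k \<rho> v)"
  unfolding generator_duality_def L_BEP_def L_SIP_R_def
  by (intro conjI ballI duality_P_eq_hyp sum.cong refl generator_terms_eq assms) auto

end
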